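(* Let $N\in\mathbb{N}$ and assume $\sup_{\theta\in\Theta}\int x^+\,Q_\theta(dx)<\infty$. If $U$ is a more risk averse utility function than $W$, then the reservation levels of the Bayesian house selling problem satisfy $$x_{n,N}^*(\mu,U)\le x_{n,N}^*(\mu,W)$$ for all $n=0,1,\dots,N-1$ and all $\mu\in\mathbb{P}(\Theta)$.
   Context: Bayesian house selling problem. $\Theta$ is a Borel space with $\mathbb{P}(\Theta)$ its set of probability measures. Given the unknown parameter $\theta\in\Theta$, offers are i.i.d. real random variables with distribution $Q_\theta$ having density $q(x|\theta)$ (jointly measurable) with respect to a $\sigma$-finite measure $\lambda$ on $\mathbb{R}$. $c>0$ is the cost paid each time an offer is rejected, and $N$ is the horizon; the aim is to maximize the expected utility of the accepted offer minus accumulated cost. Utility functions are strictly increasing concave functions $\mathbb{R}\to\mathbb{R}$; here they are also twice differentiable with positive first derivative, so that the Arrow–Pratt function $l_U(x)=-U''(x)/U'(x)$ is defined. $U$ is more risk averse than $W$ if $l_U(x)\ge l_W(x)$ for all $x\in\mathbb{R}$. Notation: $Q(\cdot|\mu)=\int_\Theta Q_\theta(\cdot)\,\mu(d\theta)$; $\Phi(x,\mu)(B)=\dfrac{\int_B q(x|\theta)\,\mu(d\theta)}{\int_\Theta q(x|\theta)\,\mu(d\theta)}$ for $B\in\mathcal{B}(\Theta)$ (a fixed arbitrary probability measure if the denominator is not in $(0,\infty)$). For a utility function $U$: $V_0(x,\mu,s)=U(x+s)$, $V_n(x,\mu,s)=\max\{U(x+s),c_n(\mu,s)\}$ with $c_n(\mu,s):=\int_{\mathbb{R}}V_{n-1}(x',\Phi(x',\mu),s-c)\,Q(dx'|\mu)$,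 $n\ge1$; $U_n(x):=U(x-nc)$, so $U_n^{-1}(y)=nc+U^{-1}(y)$. The reservation levels are $$x_{n,N}^*(\mu,U):=U_n^{-1}\big(c_{N-n}(\mu,-nc)\big),\quad n=0,\dots,N-1,$$ and $x_{n,N}^*(\mu,W)$ denotes the same quantity built from $W$. Integrals of utilities take values in $[-\infty,\infty)$; conventions $U(-\infty)=-\infty$, $U^{-1}(-\infty)=-\infty$ (same for $W$). *)

theory Defs
  imports "HOL-Probability.Probability"
begin

definition utility :: "(real \<Rightarrow> real) \<Rightarrow> bool" where
  "utility U \<longleftrightarrow> strict_mono U \<and> concave_on UNIV U"

definition smooth_utility :: "(real \<Rightarrow> real) \<Rightarrow> bool" where
  "smooth_utility U \<longleftrightarrow> utility U
     \<and> (\<forall>x. U differentiable (at x)) \<and> (\<forall>x. deriv U differentiable (at x))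
     \<and> (\<forall>x. deriv U x > 0)"

definition arrow_pratt :: "(real \<Rightarrow> real) \<Rightarrow> real \<Rightarrow> real" where
  "arrow_pratt U x = - deriv (deriv U) x / deriv U x"

definition more_risk_averse :: "(real \<Rightarrow> real) \<Rightarrow> (real \<Rightarrow> real) \<Rightarrow> bool" where
  "more_risk_averse U W \<longleftrightarrow> (\<forall>x. arrow_pratt U x \<ge> arrow_pratt W x)"

text \<open>
  The integral of an extended real function as the difference of the integrals of its positive
  and negative parts (\<^const>\<open>e2ennreal\<close> sends negative values to 0). It has its usual meaning when
  the positive part has finite integral, which is the case for all integrals of utilities below
  as soon as the offers have uniformly bounded positive parts in mean; the value may then be
  \<open>-\<infinity>\<close>.
\<close>

definition ereal_integral :: "'b measure \<Rightarrow> ('b \<Rightarrow> ereal) \<Rightarrow> ereal" where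
  "ereal_integral M f =
     enn2ereal (\<integral>\<^sup>+ x. e2ennreal (f x) \<partial>M) - enn2ereal (\<integral>\<^sup>+ x. e2ennreal (- f x) \<partial>M)"

text \<open>
  The inverse of a utility function, extended by \<open>-\<infinity> \<mapsto> -\<infinity>\<close>. The value at \<open>\<infinity>\<close> is
  immaterial, since integrals of utilities are less than \<open>\<infinity>\<close>; the finite ones lie in
  \<open>range U = (-\<infinity>, sup U)\<close>, where \<^const>\<open>inv\<close> is the actual inverse.
\<close>

definition utility_inv :: "(real \<Rightarrow> real) \<Rightarrow> ereal \<Rightarrow> ereal" where
  "utility_inv U y = (if \<bar>y\<bar> = \<infinity> then y else ereal (inv U (real_of_ereal y)))"

text \<open>\<open>offer_law lam q \<theta>\<close> is \<open>Q\<^sub>\<theta>\<close>; the value \<open>q x \<theta>\<close> is the density \<open>q(x|\<theta>)\<close>.\<close>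

definition offer_law :: "real measure \<Rightarrow> (real \<Rightarrow> 'a \<Rightarrow> real) \<Rightarrow> 'a \<Rightarrow> real measure" where
  "offer_law lam q \<theta> = density lam (\<lambda>x. ennreal (q x \<theta>))"

text \<open>The mixture \<open>Q(\<cdot>|\<mu>)\<close>, as the bind of the Giry monad; see \<open>emeasure_offer_mixture\<close>.\<close>

definition offer_mixture :: "real measure \<Rightarrow> (real \<Rightarrow> 'a \<Rightarrow> real) \<Rightarrow> 'a measure \<Rightarrow> real measure" where
  "offer_mixture lam q \<mu> = \<mu> \<bind> offer_law lam q"

text \<open>
  The Bayes operator \<open>\<Phi>(x,\<mu>)\<close>, where \<open>\<mu>0\<close> is the arbitrary probability measure used when the
  denominator is not in \<open>(0,\<infinity>)\<close>; see \<open>emeasure_bayes_update\<close>.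
\<close>

definition bayes_update ::
  "(real \<Rightarrow> 'a \<Rightarrow> real) \<Rightarrow> 'a measure \<Rightarrow> real \<Rightarrow> 'a measure \<Rightarrow> 'a measure" where
  "bayes_update q \<mu>0 x \<mu> =
     (let d = (\<integral>\<^sup>+ \<theta>. ennreal (q x \<theta>) \<partial>\<mu>)
      in if 0 < d \<and> d < \<infinity> then density \<mu> (\<lambda>\<theta>. ennreal (q x \<theta>) / d) else \<mu>0)"

primrec value_fun ::
  "real measure \<Rightarrow> (real \<Rightarrow> 'a \<Rightarrow> real) \<Rightarrow> 'a measure \<Rightarrow> real \<Rightarrow> (real \<Rightarrow> real)
     \<Rightarrow> nat \<Rightarrow> real \<Rightarrow> 'a measure \<Rightarrow> real \<Rightarrow> ereal" where
  "value_fun lam q \<mu>0 c U 0 = (\<lambda>x \<mu> s. ereal (U (x + s)))"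
| "value_fun lam q \<mu>0 c U (Suc n) = (\<lambda>x \<mu> s. max (ereal (U (x + s)))
     (ereal_integral (offer_mixture lam q \<mu>)
        (\<lambda>x'. value_fun lam q \<mu>0 c U n x' (bayes_update q \<mu>0 x' \<mu>) (s - c))))"

text \<open>\<open>continuation lam q \<mu>0 c U n \<mu> s\<close> is \<open>c\<^sub>n(\<mu>,s)\<close>; it is meaningful for \<open>n \<ge> 1\<close> only.\<close>

definition continuation ::
  "real measure \<Rightarrow> (real \<Rightarrow> 'a \<Rightarrow> real) \<Rightarrow> 'a measure \<Rightarrow> real \<Rightarrow> (real \<Rightarrow> real)
     \<Rightarrow> nat \<Rightarrow> 'a measure \<Rightarrow> real \<Rightarrow> ereal" where
  "continuation lam q \<mu>0 c U n \<mu> s = ereal_integral (offer_mixture lam q \<mu>)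
     (\<lambda>x'. value_fun lam q \<mu>0 c U (n - 1) x' (bayes_update q \<mu>0 x' \<mu>) (s - c))"

lemma value_fun_rec:
  assumes "n \<ge> 1"
  shows "value_fun lam q \<mu>0 c U n x \<mu> s
    = max (ereal (U (x + s))) (continuation lam q \<mu>0 c U n \<mu> s)"
  using assms by (cases n) (auto simp: continuation_def)

definition reservation_level ::
  "real measure \<Rightarrow> (real \<Rightarrow> 'a \<Rightarrow> real) \<Rightarrow> 'a measure \<Rightarrow> real \<Rightarrow> (real \<Rightarrow> real)
     \<Rightarrow> nat \<Rightarrow> nat \<Rightarrow> 'a measure \<Rightarrow> ereal" where
  "reservation_level lam q \<mu>0 c U n N \<mu> =
     utility_inv (\<lambda>x. U (x - real n * c))
       (continuation lam q \<mu>0 c U (N - n) \<mu> (- (real n * c)))"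

locale house_selling =
  fixes \<Theta> :: "'a :: polish_space set"
    and lam :: "real measure"
    and q :: "real \<Rightarrow> 'a \<Rightarrow> real"
    and \<mu>0 :: "'a measure"
    and c :: real
  assumes Theta_borel: "\<Theta> \<in> sets borel"
    and sets_lam: "sets lam = sets borel"
    and sigma_finite_lam: "sigma_finite_measure lam"
    and q_measurable:
      "(\<lambda>(x, \<theta>). q x \<theta>) \<in> borel_measurable (borel \<Otimes>\<^sub>M restrict_space borel \<Theta>)"
    and q_nonneg: "\<And>x \<theta>. \<theta> \<in> \<Theta> \<Longrightarrow> 0 \<le> q x \<theta>"
    and offer_law_prob: "\<And>\<theta>. \<theta> \<in> \<Theta> \<Longrightarrow> prob_space (offer_law lam q \<theta>)"
    and mu0: "\<mu>0 \<in> space (prob_algebra (restrict_space borel \<Theta>))"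
    and c_pos: "c > 0"
begin

lemma offer_law_measurable:
  "offer_law lam q \<in> measurable (restrict_space borel \<Theta>) (subprob_algebra borel)"
proof (rule measurable_subprob_algebra)
  interpret sigma_finite_measure lam by (rule sigma_finite_lam)
  have [measurable]: "(\<lambda>(\<theta>, x). q x \<theta>) \<in> borel_measurable (restrict_space borel \<Theta> \<Otimes>\<^sub>M borel)"
    using measurable_compose[OF measurable_pair_swap' q_measurable]
    by (simp add: case_prod_unfold)
  note sets_lam[measurable_cong]
  fix \<theta> assume "\<theta> \<in> space (restrict_space (borel :: 'a measure) \<Theta>)"
  then have th: "\<theta> \<in> \<Theta>" by (simp add: space_restrict_space)
  then show "subprob_space (offer_law lam q \<theta>)"
    using offer_law_prob prob_space_imp_subprob_space by blast
  show "sets (offer_law lam q \<theta>) = sets borel"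
    by (simp add: offer_law_def sets_lam)
next
  interpret sigma_finite_measure lam by (rule sigma_finite_lam)
  have m: "(\<lambda>(\<theta>, x). q x \<theta>) \<in> borel_measurable (restrict_space borel \<Theta> \<Otimes>\<^sub>M lam)"
    using measurable_compose[OF measurable_pair_swap' q_measurable] sets_lam
    by (simp add: case_prod_unfold cong: measurable_cong_sets sets_pair_measure_cong)
  fix A :: "real set" assume A: "A \<in> sets borel"
  have A': "A \<in> sets lam" using A sets_lam by simp
  have "(\<lambda>\<theta>. \<integral>\<^sup>+ x. ennreal (q x \<theta>) * indicator A x \<partial>lam)
      \<in> borel_measurable (restrict_space borel \<Theta>)"
    using m A' by measurable
  moreover have "emeasure (offer_law lam q \<theta>) A = (\<integral>\<^sup>+ x. ennreal (q x \<theta>) * indicator A x \<partial>lam)"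
    if "\<theta> \<in> space (restrict_space borel \<Theta>)" for \<theta>
    unfolding offer_law_def using measurable_compose_Pair1[OF that m] A'
    by (subst emeasure_density) simp_all
  ultimately show "(\<lambda>\<theta>. emeasure (offer_law lam q \<theta>) A)
      \<in> borel_measurable (restrict_space borel \<Theta>)"
    by (simp cong: measurable_cong)
qed

lemma emeasure_offer_mixture:
  assumes "\<mu> \<in> space (prob_algebra (restrict_space borel \<Theta>))" and "B \<in> sets borel"
  shows "emeasure (offer_mixture lam q \<mu>) B = (\<integral>\<^sup>+ \<theta>. emeasure (offer_law lam q \<theta>) B \<partial>\<mu>)"
proof -
  have s: "sets \<mu> = sets (restrict_space borel \<Theta>)" and p: "prob_space \<mu>"
    using assms(1) by (auto simp: space_prob_algebra)
  have "offer_law lam q \<in> measurable \<mu> (subprob_algebra borel)"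
    using offer_law_measurable by (simp cong: measurable_cong_sets add: s)
  then show ?thesis
    unfolding offer_mixture_def
    using emeasure_bind[OF prob_space.not_empty[OF p]] assms(2) by blast
qed

lemma emeasure_bayes_update:
  fixes x :: real
  assumes "\<mu> \<in> space (prob_algebra (restrict_space borel \<Theta>))" and "B \<in> sets \<mu>"
    and "0 < (\<integral>\<^sup>+ \<theta>. ennreal (q x \<theta>) \<partial>\<mu>)" and "(\<integral>\<^sup>+ \<theta>. ennreal (q x \<theta>) \<partial>\<mu>) < \<infinity>"
  shows "emeasure (bayes_update q \<mu>0 x \<mu>) B
    = (\<integral>\<^sup>+ \<theta>\<in>B. ennreal (q x \<theta>) \<partial>\<mu>) / (\<integral>\<^sup>+ \<theta>. ennreal (q x \<theta>) \<partial>\<mu>)"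
proof -
  have s: "sets \<mu> = sets (restrict_space borel \<Theta>)"
    using assms(1) by (auto simp: space_prob_algebra)
  have "(\<lambda>\<theta>. q x \<theta>) \<in> borel_measurable (restrict_space borel \<Theta>)"
    using measurable_compose_Pair1[OF _ q_measurable, of x] by simp
  then have [measurable]: "(\<lambda>\<theta>. q x \<theta>) \<in> borel_measurable \<mu>"
    by (simp cong: measurable_cong_sets add: s)
  define d where "d = (\<integral>\<^sup>+ \<theta>. ennreal (q x \<theta>) \<partial>\<mu>)"
  have "bayes_update q \<mu>0 x \<mu> = density \<mu> (\<lambda>\<theta>. ennreal (q x \<theta>) / d)"
    using assms(3,4) by (simp add: bayes_update_def d_def)
  moreover have "emeasure (density \<mu> (\<lambda>\<theta>. ennreal (q x \<theta>) / d)) B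
      = (\<integral>\<^sup>+ \<theta>. ennreal (q x \<theta>) / d * indicator B \<theta> \<partial>\<mu>)"
    using assms(2) by (subst emeasure_density) auto
  moreover have "\<dots> = (\<integral>\<^sup>+ \<theta>. (ennreal (q x \<theta>) * indicator B \<theta>) / d \<partial>\<mu>)"
    by (intro nn_integral_cong) (auto simp: indicator_def)
  moreover have "\<dots> = (\<integral>\<^sup>+ \<theta>\<in>B. ennreal (q x \<theta>) \<partial>\<mu>) / d"
    using assms(2) by (subst nn_integral_divide) auto
  ultimately show ?thesis by (simp add: d_def)
qed

end

end

theory Submission imports Defs begin

text \<open>
  A reservation level is, up to the cost already paid, the certainty equivalent of continuing:
  the sure payoff whose utility equals the value of continuing. The theorem says that the more
  risk averse searcher has the smaller certainty equivalents, as in Pratt's theorem for a single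
  gamble. Two points go beyond Pratt: the gamble is itself the value of an optimal stopping
  problem, which depends on the utility function, and expected utilities may be \<open>-\<infinity>\<close>.

  The analytic core is \<open>more_risk_averse_support\<close>. The derivative of \<open>U' / W'\<close> has the sign of
  \<open>l\<^sub>W - l\<^sub>U\<close>, so this ratio is nonincreasing, and hence \<open>U\<close> lies below an increasing affine
  function of \<open>W\<close> that touches it at any prescribed point \<open>z0\<close>. This is the supporting line
  of the concave function \<open>U \<circ> W\<^sup>-\<^sup>1\<close>. Choosing \<open>z0\<close> as the certainty equivalent for \<open>W\<close> and
  integrating gives Jensen's inequality (\<open>risk_averse_Jensen\<close>); if the expected \<open>W\<close>-utility
  is \<open>-\<infinity>\<close>, any supporting line shows that the expected \<open>U\<close>-utility is \<open>-\<infinity>\<close> as well.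

  Induction on the remaining horizon then handles the optimal stopping problem
  (\<open>value_fun_certainty_equivalent\<close>): every value of the problem for \<open>W\<close> has the form \<open>W z\<close>,
  and the corresponding value for \<open>U\<close> is at most \<open>U z\<close>. The statement is preserved by
  integration because of Jensen's inequality, and by the maximum with the utility of the current
  offer because \<open>U\<close> and \<open>W\<close> are increasing.

  Jensen's inequality needs the value function of \<open>W\<close> to be measurable and to have an integrable
  positive part. Measurability is proved jointly in offer and prior
  (\<open>value_fun_measurable\<close>), since the posterior depends on the offer. The positive part is
  controlled by a bound that is affine in \<open>x\<^sup>+\<close> and uniform in the prior
  (\<open>value_fun_linear_growth\<close>); this is where the uniform bound on the mean positive part of the
  offers enters.
\<close>

section \<open>Smooth utilities and risk aversion\<close>

lemma smooth_utilityD: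
  assumes "smooth_utility U"
  shows "strict_mono U" "concave_on UNIV U"
    "(U has_real_derivative deriv U x) (at x)"
    "(deriv U has_real_derivative deriv (deriv U) x) (at x)"
    "deriv U x > 0"
  using assms
  by (auto simp: smooth_utility_def utility_def DERIV_deriv_iff_real_differentiable)

lemma utility_below_tangent:
  assumes "smooth_utility U"
  shows "U x \<le> U y + deriv U y * (x - y)"
proof -
  note U = smooth_utilityD[OF assms]
  have "convex_on UNIV (\<lambda>x. - U x)" using U(2) by (simp add: concave_on_def)
  moreover have "((\<lambda>x. - U x) has_real_derivative - deriv U y) (at y)"
    using U(3) by (rule DERIV_minus)
  ultimately have "- U x - - U y \<ge> - deriv U y * (x - y)"
    using convex_on_imp_above_tangent[of UNIV "\<lambda>x. - U x" y x "- deriv U y"] by simp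
  then show ?thesis by simp
qed

lemma utility_borel_measurable:
  assumes "smooth_utility U"
  shows "U \<in> borel_measurable borel"
proof (intro borel_measurable_continuous_onI continuous_at_imp_continuous_on ballI)
  show "isCont U x" for x using smooth_utilityD(3)[OF assms] by (rule DERIV_isCont)
qed

text \<open>
  A tangent line has positive slope, so a utility function is unbounded below, and the
  intermediate value theorem applies.
\<close>

lemma utility_range_downward_closed:
  assumes U: "smooth_utility U" and "y \<le> U z"
  obtains z' where "U z' = y"
proof -
  \<comment> \<open>the point at which the tangent at \<open>z\<close> takes the value \<open>y\<close>\<close>
  define w where "w = z + (y - U z) / deriv U z"
  have pos: "deriv U z > 0" by (rule smooth_utilityD[OF U])
  have "U w \<le> U z + deriv U z * (w - z)" by (rule utility_below_tangent[OF U])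
  also have "\<dots> = y" using pos by (simp add: w_def)
  finally have "U w \<le> y" .
  moreover have "w \<le> z" using assms(2) pos by (simp add: w_def divide_nonpos_pos)
  moreover have "\<forall>x. w \<le> x \<and> x \<le> z \<longrightarrow> isCont U x"
    using smooth_utilityD(3)[OF U] DERIV_isCont by blast
  ultimately show ?thesis using IVT[of U w y z] assms(2) that by blast
qed

lemma marginal_utility_ratio_antimono:
  assumes U: "smooth_utility U" and W: "smooth_utility W" and "more_risk_averse U W"
    and "x \<le> y"
  shows "deriv U y / deriv W y \<le> deriv U x / deriv W x"
proof (rule DERIV_nonpos_imp_nonincreasing[OF \<open>x \<le> y\<close>])
  fix t
  note u = smooth_utilityD(4,5)[OF U, of t] and w = smooth_utilityD(4,5)[OF W, of t]
  have "- deriv (deriv W) t / deriv W t \<le> - deriv (deriv U) t / deriv U t"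
    using assms(3) by (simp add: more_risk_averse_def arrow_pratt_def)
  then have "deriv (deriv U) t * deriv W t \<le> deriv U t * deriv (deriv W) t"
    using u(2) w(2) by (simp add: field_simps)
  then have "(deriv (deriv U) t * deriv W t - deriv U t * deriv (deriv W) t)
      / (deriv W t * deriv W t) \<le> 0"
    by (simp add: divide_nonpos_nonneg)
  moreover have "((\<lambda>t. deriv U t / deriv W t) has_real_derivative
      (deriv (deriv U) t * deriv W t - deriv U t * deriv (deriv W) t)
      / (deriv W t * deriv W t)) (at t)"
    using u(1) w by (intro DERIV_divide) auto
  ultimately show "\<exists>D. ((\<lambda>t. deriv U t / deriv W t) has_real_derivative D) (at t) \<and> D \<le> 0"
    by blast
qed

text \<open>
  The function \<open>U - k W\<close> with \<open>k = U'(z0) / W'(z0)\<close> has derivative \<open>W' (U'/W' - k)\<close>. As \<open>U'/W'\<close>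
  is nonincreasing, this is nonnegative to the left of \<open>z0\<close> and nonpositive to the right, so
  \<open>U - k W\<close> is maximal at \<open>z0\<close>.
\<close>

lemma more_risk_averse_support:
  assumes U: "smooth_utility U" and W: "smooth_utility W" and "more_risk_averse U W"
  shows "U z \<le> U z0 + deriv U z0 / deriv W z0 * (W z - W z0)"
proof -
  define k where "k = deriv U z0 / deriv W z0"
  define h where "h = (\<lambda>z. U z - k * W z)"
  have h': "(h has_real_derivative deriv U t - k * deriv W t) (at t)" for t
    unfolding h_def
    by (intro DERIV_diff DERIV_cmult smooth_utilityD(3)[OF U] smooth_utilityD(3)[OF W])
  have pos: "deriv W t > 0" for t by (rule smooth_utilityD[OF W])
  have "h z \<le> h z0"
  proof (cases "z \<le> z0")
    case True
    then show ?thesis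
    proof (rule DERIV_nonneg_imp_nondecreasing)
      fix t assume "z \<le> t" "t \<le> z0"
      then have "k \<le> deriv U t / deriv W t"
        using marginal_utility_ratio_antimono[OF U W assms(3), of t z0] by (simp add: k_def)
      then have "0 \<le> deriv U t - k * deriv W t" using pos[of t] by (simp add: field_simps)
      with h' show "\<exists>D. (h has_real_derivative D) (at t) \<and> 0 \<le> D" by blast
    qed
  next
    case False
    then have "z0 \<le> z" by simp
    then show ?thesis
    proof (rule DERIV_nonpos_imp_nonincreasing)
      fix t assume "z0 \<le> t" "t \<le> z"
      then have "deriv U t / deriv W t \<le> k"
        using marginal_utility_ratio_antimono[OF U W assms(3), of z0 t] by (simp add: k_def)
      then have "deriv U t - k * deriv W t \<le> 0" using pos[of t] by (simp add: field_simps)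
      with h' show "\<exists>D. (h has_real_derivative D) (at t) \<and> D \<le> 0" by blast
    qed
  qed
  then show ?thesis by (simp add: h_def k_def[symmetric] right_diff_distrib)
qed

section \<open>Integrals with values in the extended reals\<close>

lemma ereal_integral_mono:
  assumes "\<And>x. x \<in> space M \<Longrightarrow> f x \<le> g x"
  shows "ereal_integral M f \<le> ereal_integral M g"
  unfolding ereal_integral_def
proof (intro ereal_minus_mono)
  show "enn2ereal (\<integral>\<^sup>+ x. e2ennreal (f x) \<partial>M) \<le> enn2ereal (\<integral>\<^sup>+ x. e2ennreal (g x) \<partial>M)"
    unfolding less_eq_ennreal.rep_eq[symmetric]
    using assms by (intro nn_integral_mono e2ennreal_mono)
  show "enn2ereal (\<integral>\<^sup>+ x. e2ennreal (- g x) \<partial>M) \<le> enn2ereal (\<integral>\<^sup>+ x. e2ennreal (- f x) \<partial>M)"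
    unfolding less_eq_ennreal.rep_eq[symmetric]
    using assms by (intro nn_integral_mono e2ennreal_mono) simp
qed

lemma ereal_integral_cong:
  assumes "\<And>x. x \<in> space M \<Longrightarrow> f x = g x"
  shows "ereal_integral M f = ereal_integral M g"
  using assms by (intro antisym ereal_integral_mono) auto

lemma ereal_integral_le_nn_integral:
  "ereal_integral M f \<le> enn2ereal (\<integral>\<^sup>+ x. e2ennreal (f x) \<partial>M)"
  unfolding ereal_integral_def by (simp add: ereal_diff_le_self)

lemma ereal_integral_integrable:
  assumes "integrable M f"
  shows "ereal_integral M (\<lambda>x. ereal (f x)) = ereal (integral\<^sup>L M f)"
proof -
  obtain r s where rs: "0 \<le> r" "0 \<le> s" "(\<integral>\<^sup>+ x. ennreal (f x) \<partial>M) = ennreal r"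
    "(\<integral>\<^sup>+ x. ennreal (- f x) \<partial>M) = ennreal s" "integral\<^sup>L M f = r - s"
    using integrableE[OF assms] by metis
  then show ?thesis by (simp add: ereal_integral_def)
qed

lemma ereal_integral_not_integrable:
  assumes "f \<in> borel_measurable M" "(\<integral>\<^sup>+ x. ennreal (f x) \<partial>M) < \<infinity>" "\<not> integrable M f"
  shows "ereal_integral M (\<lambda>x. ereal (f x)) = -\<infinity>"
proof -
  have "(\<integral>\<^sup>+ x. ennreal (- f x) \<partial>M) = \<infinity>"
    using assms by (auto simp: real_integrable_def)
  moreover obtain r where "0 \<le> r" "(\<integral>\<^sup>+ x. ennreal (f x) \<partial>M) = ennreal r"
    using assms(2) by (cases "\<integral>\<^sup>+ x. ennreal (f x) \<partial>M") auto
  ultimately show ?thesis by (simp add: ereal_integral_def)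
qed

text \<open>
  The range of \<open>W\<close> is closed downwards, so a mean outside of it would strictly exceed every value
  of the variable. This also covers a bounded \<open>W\<close>, whose supremum is not attained.
\<close>

lemma (in prob_space) integral_in_utility_range:
  assumes W: "smooth_utility W" and Y: "integrable M Y"
    and range: "\<And>x. x \<in> space M \<Longrightarrow> Y x \<in> range W"
  obtains z where "integral\<^sup>L M Y = W z"
proof (rule ccontr)
  assume no: "\<not> thesis"
  have "W z < integral\<^sup>L M Y" for z
  proof (rule ccontr)
    assume "\<not> W z < integral\<^sup>L M Y"
    then obtain z' where "W z' = integral\<^sup>L M Y"
      using utility_range_downward_closed[OF W, of "integral\<^sup>L M Y" z] by auto
    with that[of z'] no show False by simp
  qed
  with range have "AE x in M. Y x < integral\<^sup>L M Y" by (intro AE_I2) fastforce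
  then have "integral\<^sup>L M Y < integral\<^sup>L M (\<lambda>_. integral\<^sup>L M Y)"
    by (intro integral_less_AE_space Y) (auto simp: emeasure_space_1)
  then show False by (simp add: prob_space)
qed

text \<open>
  Pratt's comparison of certainty equivalents, stated without inverse functions: \<open>Y\<close> is the
  \<open>W\<close>-utility of a random payoff, \<open>X\<close> is at most its \<open>U\<close>-utility, and the \<open>z\<close> of the second
  alternative is the certainty equivalent for \<open>W\<close>. Only an upper bound on the integral of \<open>X\<close> is
  needed, so monotonicity of \<^const>\<open>ereal_integral\<close> reduces everything to integrals of affine
  functions of \<open>Y\<close>.
\<close>

lemma (in prob_space) risk_averse_Jensen:
  assumes U: "smooth_utility U" and W: "smooth_utility W" and ra: "more_risk_averse U W"
    and Y[measurable]: "Y \<in> borel_measurable M"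
    and fin: "(\<integral>\<^sup>+ x. e2ennreal (Y x) \<partial>M) < \<infinity>"
    and XY: "\<And>x. x \<in> space M \<Longrightarrow> \<exists>z. Y x = ereal (W z) \<and> X x \<le> ereal (U z)"
  shows "(ereal_integral M Y = -\<infinity> \<and> ereal_integral M X = -\<infinity>) \<or>
    (\<exists>z. ereal_integral M Y = ereal (W z) \<and> ereal_integral M X \<le> ereal (U z))"
proof -
  define y where "y = (\<lambda>x. real_of_ereal (Y x))"
  have [measurable]: "y \<in> borel_measurable M" by (simp add: y_def)
  have y: "\<exists>z. y x = W z \<and> X x \<le> ereal (U z)" if "x \<in> space M" for x
    using XY[OF that] by (auto simp: y_def)
  have Yy: "Y x = ereal (y x)" if "x \<in> space M" for x
    using XY[OF that] by (auto simp: y_def)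
  have IY: "ereal_integral M Y = ereal_integral M (\<lambda>x. ereal (y x))"
    using Yy by (rule ereal_integral_cong)
  have fin_y: "(\<integral>\<^sup>+ x. ennreal (y x) \<partial>M) < \<infinity>"
    using fin Yy by (simp cong: nn_integral_cong)
  \<comment> \<open>\<open>g z0\<close> is the supporting line at \<open>z0\<close>, evaluated at the \<open>W\<close>-utility\<close>
  define k where "k z0 = deriv U z0 / deriv W z0" for z0
  have k: "k z0 > 0" for z0
    using smooth_utilityD(5)[OF U] smooth_utilityD(5)[OF W] by (simp add: k_def)
  define g where "g z0 = (\<lambda>x. U z0 + k z0 * (y x - W z0))" for z0
  have [measurable]: "g z0 \<in> borel_measurable M" for z0 by (simp add: g_def)
  have IX: "ereal_integral M X \<le> ereal_integral M (\<lambda>x. ereal (g z0 x))" for z0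
  proof (rule ereal_integral_mono)
    fix x assume "x \<in> space M"
    then obtain z where z: "y x = W z" "X x \<le> ereal (U z)" using y by blast
    then show "X x \<le> ereal (g z0 x)"
      using more_risk_averse_support[OF U W ra, of z z0] order.trans
      by (fastforce simp: g_def k_def)
  qed
  show ?thesis
  proof (cases "integrable M y")
    case True
    \<comment> \<open>at the certainty equivalent \<open>z0\<close> for \<open>W\<close> the linear term of \<open>g z0\<close> integrates to \<open>0\<close>\<close>
    then obtain z0 where z0: "integral\<^sup>L M y = W z0"
      using integral_in_utility_range[OF W True] y by blast
    have int: "integrable M (g z0)" using True by (simp add: g_def)
    have "integral\<^sup>L M (g z0) = U z0"
      using True by (simp add: g_def z0 prob_space)
    then show ?thesis
      using IX[of z0] IY z0 ereal_integral_integrable[OF True] ereal_integral_integrable[OF int]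
      by auto
  next
    case False
    \<comment> \<open>\<open>Y\<close> has integral \<open>-\<infinity>\<close>; so has any increasing affine function of it, such as \<open>g 0\<close>\<close>
    let ?a = "\<bar>U 0 - k 0 * W 0\<bar>"
    have "(\<integral>\<^sup>+ x. ennreal (g 0 x) \<partial>M) \<le> (\<integral>\<^sup>+ x. ennreal ?a + ennreal (k 0) * ennreal (y x) \<partial>M)"
    proof (rule nn_integral_mono)
      fix x
      have "k 0 * y x \<le> k 0 * max 0 (y x)" using k[of 0] by (intro mult_left_mono) auto
      moreover have "g 0 x = U 0 - k 0 * W 0 + k 0 * y x"
        by (simp add: g_def right_diff_distrib)
      ultimately have "g 0 x \<le> ?a + k 0 * max 0 (y x)" by linarith
      then have "ennreal (g 0 x) \<le> ennreal (?a + k 0 * max 0 (y x))" by (rule ennreal_leI)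
      also have "\<dots> = ennreal ?a + ennreal (k 0) * ennreal (y x)"
        using k[of 0] by (simp add: ennreal_mult max_def ennreal_neg)
      finally show "ennreal (g 0 x) \<le> ennreal ?a + ennreal (k 0) * ennreal (y x)" .
    qed
    also have "\<dots> = ennreal ?a + ennreal (k 0) * (\<integral>\<^sup>+ x. ennreal (y x) \<partial>M)"
      by (simp add: nn_integral_add nn_integral_cmult emeasure_space_1)
    also have "\<dots> < \<infinity>" using fin_y by (simp add: ennreal_mult_less_top)
    finally have fin_g: "(\<integral>\<^sup>+ x. ennreal (g 0 x) \<partial>M) < \<infinity>" .
    have "\<not> integrable M (g 0)"
    proof
      assume "integrable M (g 0)"
      then have "integrable M (\<lambda>x. (g 0 x - U 0) / k 0 + W 0)" by simp
      moreover have "(g 0 x - U 0) / k 0 + W 0 = y x" for x using k[of 0] by (simp add: g_def)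
      ultimately show False using False by simp
    qed
    then have "ereal_integral M (\<lambda>x. ereal (g 0 x)) = -\<infinity>"
      by (intro ereal_integral_not_integrable fin_g) auto
    then show ?thesis
      using IX[of 0] IY ereal_integral_not_integrable[OF _ fin_y False] by auto
  qed
qed

section \<open>Measurability of the posterior and of the value functions\<close>

context house_selling
begin

abbreviation priors :: "'a measure measure" where
  "priors \<equiv> prob_algebra (restrict_space borel \<Theta>)"

lemma offer_mixture_measurable: "offer_mixture lam q \<in> priors \<rightarrow>\<^sub>M prob_algebra borel"
proof -
  have "offer_law lam q \<in> restrict_space borel \<Theta> \<rightarrow>\<^sub>M prob_algebra borel"
    by (intro measurable_prob_algebraI offer_law_measurable)
      (simp add: offer_law_prob space_restrict_space)
  then show ?thesis
    unfolding offer_mixture_def[abs_def]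
    by (rule measurable_bind_prob_space[OF measurable_ident_sets[OF refl]])
qed

lemma bayes_update_in_priors:
  assumes "\<mu> \<in> space priors"
  shows "bayes_update q \<mu>0 x \<mu> \<in> space priors"
proof (cases "0 < (\<integral>\<^sup>+ \<theta>. ennreal (q x \<theta>) \<partial>\<mu>) \<and> (\<integral>\<^sup>+ \<theta>. ennreal (q x \<theta>) \<partial>\<mu>) < \<infinity>")
  case True
  have sets: "sets (bayes_update q \<mu>0 x \<mu>) = sets \<mu>"
    using True by (simp add: bayes_update_def Let_def)
  have "emeasure (bayes_update q \<mu>0 x \<mu>) (space \<mu>) = 1"
    using emeasure_bayes_update[OF assms sets.top] True
    by simp
  then have "prob_space (bayes_update q \<mu>0 x \<mu>)"
    by (intro prob_spaceI) (simp add: sets_eq_imp_space_eq[OF sets])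
  then show ?thesis using sets assms by (simp add: space_prob_algebra)
next
  case False
  then show ?thesis using mu0 by (auto simp: bayes_update_def Let_def)
qed

text \<open>
  The posterior probability of a set is a quotient of two integrals with respect to the prior, each
  of which is a measurable function of offer and prior, since the density is jointly measurable.
\<close>

lemma bayes_update_measurable:
  "(\<lambda>(x, \<mu>). bayes_update q \<mu>0 x \<mu>) \<in> borel \<Otimes>\<^sub>M priors \<rightarrow>\<^sub>M priors"
proof (intro measurable_prob_algebraI measurable_subprob_algebra)
  fix p :: "real \<times> 'a measure" assume "p \<in> space (borel \<Otimes>\<^sub>M priors)"
  then have "(case p of (x, \<mu>) \<Rightarrow> bayes_update q \<mu>0 x \<mu>) \<in> space priors"
    by (auto simp: space_pair_measure intro: bayes_update_in_priors)
  then show "prob_space (case p of (x, \<mu>) \<Rightarrow> bayes_update q \<mu>0 x \<mu>)"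
    "subprob_space (case p of (x, \<mu>) \<Rightarrow> bayes_update q \<mu>0 x \<mu>)"
    "sets (case p of (x, \<mu>) \<Rightarrow> bayes_update q \<mu>0 x \<mu>) = sets (restrict_space borel \<Theta>)"
    by (auto simp: space_prob_algebra intro: prob_space_imp_subprob_space)
next
  fix B assume B[measurable]: "B \<in> sets (restrict_space (borel :: 'a measure) \<Theta>)"
  let ?M = "(borel :: real measure) \<Otimes>\<^sub>M priors"
  have num: "(\<lambda>p. \<integral>\<^sup>+ \<theta>\<in>A. ennreal (q (fst p) \<theta>) \<partial>snd p) \<in> borel_measurable ?M"
    if [measurable]: "A \<in> sets (restrict_space (borel :: 'a measure) \<Theta>)" for A
  proof (rule nn_integral_measurable_subprob_algebra2)
    have "(\<lambda>p. (fst (fst p), snd p)) \<in>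
        ?M \<Otimes>\<^sub>M restrict_space borel \<Theta> \<rightarrow>\<^sub>M borel \<Otimes>\<^sub>M restrict_space (borel :: 'a measure) \<Theta>"
      by measurable
    from measurable_compose[OF this q_measurable]
    have [measurable]: "(\<lambda>p. q (fst (fst p)) (snd p)) \<in>
        borel_measurable (?M \<Otimes>\<^sub>M restrict_space borel \<Theta>)" by simp
    show "(\<lambda>(p, \<theta>). ennreal (q (fst p) \<theta>) * indicator A \<theta>) \<in>
        borel_measurable (?M \<Otimes>\<^sub>M restrict_space borel \<Theta>)" by measurable
    show "snd \<in> ?M \<rightarrow>\<^sub>M subprob_algebra (restrict_space borel \<Theta>)"
      by (intro measurable_prob_algebraD measurable_snd)
  qed
  \<comment> \<open>the denominator is the case of the whole space, which is the same set for every prior\<close>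
  have "(\<lambda>p. \<integral>\<^sup>+ \<theta>. ennreal (q (fst p) \<theta>) \<partial>snd p) \<in> borel_measurable ?M \<longleftrightarrow>
      (\<lambda>p. \<integral>\<^sup>+ \<theta>\<in>space (restrict_space borel \<Theta>). ennreal (q (fst p) \<theta>) \<partial>snd p) \<in> borel_measurable ?M"
  proof (intro measurable_cong)
    fix p assume "p \<in> space ?M"
    then have "snd p \<in> space priors" by (auto simp: space_pair_measure)
    then have "sets (snd p) = sets (restrict_space borel \<Theta>)"
      unfolding space_prob_algebra by blast
    then have "space (restrict_space borel \<Theta>) = space (snd p)"
      by (rule sets_eq_imp_space_eq[symmetric])
    then show "(\<integral>\<^sup>+ \<theta>. ennreal (q (fst p) \<theta>) \<partial>snd p) =
        (\<integral>\<^sup>+ \<theta>\<in>space (restrict_space borel \<Theta>). ennreal (q (fst p) \<theta>) \<partial>snd p)"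
      by simp
  qed
  with num[OF sets.top]
  have den: "(\<lambda>p. \<integral>\<^sup>+ \<theta>. ennreal (q (fst p) \<theta>) \<partial>snd p) \<in> borel_measurable ?M" by simp
  define d where "d = (\<lambda>p. \<integral>\<^sup>+ \<theta>. ennreal (q (fst p) \<theta>) \<partial>snd p)"
  define m where "m = (\<lambda>p. \<integral>\<^sup>+ \<theta>\<in>B. ennreal (q (fst p) \<theta>) \<partial>snd p)"
  have [measurable]: "d \<in> borel_measurable ?M" "m \<in> borel_measurable ?M"
    using den num[OF B] by (simp_all add: d_def m_def)
  have "(\<lambda>p. if 0 < d p \<and> d p < \<infinity> then m p / d p else e) \<in> borel_measurable ?M" for e
    by measurable
  moreover have "emeasure (case p of (x, \<mu>) \<Rightarrow> bayes_update q \<mu>0 x \<mu>) B =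
      (if 0 < d p \<and> d p < \<infinity> then m p / d p else emeasure \<mu>0 B)" if "p \<in> space ?M" for p
  proof (cases p)
    case (Pair x \<mu>)
    then have \<mu>: "\<mu> \<in> space priors" using that by (simp add: space_pair_measure)
    then have "B \<in> sets \<mu>" using B by (simp add: space_prob_algebra)
    from emeasure_bayes_update[OF \<mu> this, of x] Pair show ?thesis
      by (auto simp: d_def m_def bayes_update_def Let_def)
  qed
  ultimately show "(\<lambda>p. emeasure (case p of (x, \<mu>) \<Rightarrow> bayes_update q \<mu>0 x \<mu>) B) \<in> borel_measurable ?M"
    by (simp cong: measurable_cong)
qed

lemma value_fun_measurable:
  assumes W: "smooth_utility W"
  shows "(\<lambda>(x, \<mu>). value_fun lam q \<mu>0 c W n x \<mu> s) \<in> borel_measurable (borel \<Otimes>\<^sub>M priors)"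
proof (induction n arbitrary: s)
  case 0
  note utility_borel_measurable[OF W, measurable]
  show ?case by simp
next
  case (Suc n)
  note utility_borel_measurable[OF W, measurable]
  let ?V = "\<lambda>x \<mu>. value_fun lam q \<mu>0 c W n x (bayes_update q \<mu>0 x \<mu>) (s - c)"
  have "(\<lambda>p. (snd p, case (snd p, fst p) of (x, \<mu>) \<Rightarrow> bayes_update q \<mu>0 x \<mu>))
      \<in> priors \<Otimes>\<^sub>M borel \<rightarrow>\<^sub>M borel \<Otimes>\<^sub>M priors"
    by (intro measurable_Pair measurable_snd measurable_compose[OF _ bayes_update_measurable]
        measurable_fst)
  from measurable_compose[OF this Suc.IH[of "s - c"]]
  have V[measurable]: "(\<lambda>(\<mu>, x). ?V x \<mu>) \<in> borel_measurable (priors \<Otimes>\<^sub>M borel)"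
    by (simp add: case_prod_unfold)
  note L = measurable_prob_algebraD[OF offer_mixture_measurable]
  have [measurable]:
    "(\<lambda>\<mu>. \<integral>\<^sup>+ x. e2ennreal (?V x \<mu>) \<partial>offer_mixture lam q \<mu>) \<in> borel_measurable priors"
    "(\<lambda>\<mu>. \<integral>\<^sup>+ x. e2ennreal (- ?V x \<mu>) \<partial>offer_mixture lam q \<mu>) \<in> borel_measurable priors"
    by (intro nn_integral_measurable_subprob_algebra2[OF _ L]; measurable)+
  show ?case by (simp add: ereal_integral_def case_prod_unfold)
qed

section \<open>Integrability of the value functions\<close>

lemma nn_integral_offer_mixture_le:
  assumes K: "\<And>\<theta>. \<theta> \<in> \<Theta> \<Longrightarrow> (\<integral>\<^sup>+ x. ennreal (max 0 x) \<partial>offer_law lam q \<theta>) \<le> ennreal K"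
    and \<mu>: "\<mu> \<in> space priors"
  shows "(\<integral>\<^sup>+ x. ennreal (max 0 x) \<partial>offer_mixture lam q \<mu>) \<le> ennreal K"
proof -
  have sets: "sets \<mu> = sets (restrict_space borel \<Theta>)" and prob: "prob_space \<mu>"
    using \<mu> by (auto simp: space_prob_algebra)
  interpret prob_space \<mu> by (rule prob)
  have L: "offer_law lam q \<in> \<mu> \<rightarrow>\<^sub>M subprob_algebra borel"
    using offer_law_measurable by (simp cong: measurable_cong_sets add: sets)
  have "space \<mu> = \<Theta>"
    using sets_eq_imp_space_eq[OF sets] by (simp add: space_restrict_space)
  then have "(\<integral>\<^sup>+ \<theta>. \<integral>\<^sup>+ x. ennreal (max 0 x) \<partial>offer_law lam q \<theta> \<partial>\<mu>) \<le> (\<integral>\<^sup>+ \<theta>. ennreal K \<partial>\<mu>)"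
    using K by (intro nn_integral_mono) simp
  then show ?thesis
    unfolding offer_mixture_def by (subst nn_integral_bind[OF _ L]) (auto simp: emeasure_space_1)
qed

lemma nn_integral_linear_growth_le:
  assumes K: "\<And>\<theta>. \<theta> \<in> \<Theta> \<Longrightarrow> (\<integral>\<^sup>+ x. ennreal (max 0 x) \<partial>offer_law lam q \<theta>) \<le> ennreal K"
    and "0 \<le> K" "0 \<le> b" and \<mu>: "\<mu> \<in> space priors"
    and V: "\<And>x. V x \<le> ereal (a + b * max 0 x)"
  shows "(\<integral>\<^sup>+ x. e2ennreal (V x) \<partial>offer_mixture lam q \<mu>) \<le> ennreal (\<bar>a\<bar> + b * K)"
proof -
  have "offer_mixture lam q \<mu> \<in> space (prob_algebra borel)"
    using offer_mixture_measurable \<mu> by (rule measurable_space)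
  then have sets[measurable_cong]: "sets (offer_mixture lam q \<mu>) = sets borel"
    and prob: "prob_space (offer_mixture lam q \<mu>)" by (auto simp: space_prob_algebra)
  interpret prob_space "offer_mixture lam q \<mu>" by (rule prob)
  have "(\<integral>\<^sup>+ x. e2ennreal (V x) \<partial>offer_mixture lam q \<mu>)
      \<le> (\<integral>\<^sup>+ x. ennreal \<bar>a\<bar> + ennreal b * ennreal (max 0 x) \<partial>offer_mixture lam q \<mu>)"
  proof (rule nn_integral_mono)
    fix x
    have "V x \<le> ereal (\<bar>a\<bar> + b * max 0 x)" using V[of x] by (rule order.trans) simp
    then have "e2ennreal (V x) \<le> ennreal (\<bar>a\<bar> + b * max 0 x)"
      using e2ennreal_mono by fastforce
    then show "e2ennreal (V x) \<le> ennreal \<bar>a\<bar> + ennreal b * ennreal (max 0 x)"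
      using \<open>0 \<le> b\<close> by (simp add: ennreal_mult)
  qed
  also have "\<dots> = ennreal \<bar>a\<bar> + ennreal b * (\<integral>\<^sup>+ x. ennreal (max 0 x) \<partial>offer_mixture lam q \<mu>)"
    by (simp add: nn_integral_add nn_integral_cmult emeasure_space_1)
  also have "\<dots> \<le> ennreal \<bar>a\<bar> + ennreal b * ennreal K"
    using nn_integral_offer_mixture_le[OF K \<mu>] by (intro add_mono mult_left_mono) auto
  also have "\<dots> = ennreal (\<bar>a\<bar> + b * K)"
    using \<open>0 \<le> K\<close> \<open>0 \<le> b\<close> by (simp add: ennreal_mult)
  finally show ?thesis .
qed

text \<open>
  The slope \<open>W'(0)\<close> works for all \<open>n\<close> and \<open>s\<close>: the utility of the current offer lies below the
  tangent of \<open>W\<close> at \<open>0\<close>, and the value of continuing is bounded by a constant that depends on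
  neither offer nor prior, because the mean of \<open>x\<^sup>+\<close> is at most \<open>K\<close> under every mixture. Uniformity
  in the prior is what lets the induction pass through the Bayes update.
\<close>

lemma value_fun_linear_growth:
  assumes W: "smooth_utility W"
    and K: "\<And>\<theta>. \<theta> \<in> \<Theta> \<Longrightarrow> (\<integral>\<^sup>+ x. ennreal (max 0 x) \<partial>offer_law lam q \<theta>) \<le> ennreal K"
    and "0 \<le> K"
  shows "\<exists>a. \<forall>x. \<forall>\<mu>\<in>space priors.
    value_fun lam q \<mu>0 c W n x \<mu> s \<le> ereal (a + deriv W 0 * max 0 x)"
proof (induction n arbitrary: s)
  have b: "0 < deriv W 0" by (rule smooth_utilityD[OF W])
  have base: "W (x + s) \<le> (W 0 + deriv W 0 * s) + deriv W 0 * max 0 x" for x s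
  proof -
    have "deriv W 0 * x \<le> deriv W 0 * max 0 x" using b by (intro mult_left_mono) auto
    with utility_below_tangent[OF W, of "x + s" 0] show ?thesis by (simp add: distrib_left)
  qed
  case 0
  show ?case using base by auto
  case (Suc n)
  obtain a where a: "value_fun lam q \<mu>0 c W n x \<mu> (s - c) \<le> ereal (a + deriv W 0 * max 0 x)"
    if "\<mu> \<in> space priors" for x \<mu>
    using Suc.IH[of "s - c"] by blast
  let ?a = "\<bar>W 0 + deriv W 0 * s\<bar> + (\<bar>a\<bar> + deriv W 0 * K)"
  have "value_fun lam q \<mu>0 c W (Suc n) x \<mu> s \<le> ereal (?a + deriv W 0 * max 0 x)"
    if \<mu>: "\<mu> \<in> space priors" for x \<mu>
  proof -
    have nn: "0 \<le> deriv W 0 * K" "0 \<le> deriv W 0 * max 0 x" using b \<open>0 \<le> K\<close> by auto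
    let ?V = "\<lambda>x'. value_fun lam q \<mu>0 c W n x' (bayes_update q \<mu>0 x' \<mu>) (s - c)"
    have "(\<integral>\<^sup>+ x'. e2ennreal (?V x') \<partial>offer_mixture lam q \<mu>) \<le> ennreal (\<bar>a\<bar> + deriv W 0 * K)"
      using b by (intro nn_integral_linear_growth_le K \<mu> a bayes_update_in_priors \<open>0 \<le> K\<close>) auto
    then have "enn2ereal (\<integral>\<^sup>+ x'. e2ennreal (?V x') \<partial>offer_mixture lam q \<mu>)
        \<le> ereal (\<bar>a\<bar> + deriv W 0 * K)"
      using nn by (simp add: less_eq_ennreal.rep_eq del: ennreal_plus)
    then have "ereal_integral (offer_mixture lam q \<mu>) ?V \<le> ereal (\<bar>a\<bar> + deriv W 0 * K)"
      by (rule order.trans[OF ereal_integral_le_nn_integral])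
    also have "\<dots> \<le> ereal (?a + deriv W 0 * max 0 x)" using nn by simp
    finally show ?thesis using base[of x s] nn by simp
  qed
  then show ?case by blast
qed

section \<open>Comparison of certainty equivalents\<close>

text \<open>
  The step from values to continuation values: \<open>risk_averse_Jensen\<close> for the mixture of the offer
  laws, with measurability and integrability supplied by the two preceding sections. The hypothesis
  on the values is the induction hypothesis of \<open>value_fun_certainty_equivalent\<close>.
\<close>

lemma continuation_certainty_equivalent:
  assumes U: "smooth_utility U" and W: "smooth_utility W" and ra: "more_risk_averse U W"
    and K: "\<And>\<theta>. \<theta> \<in> \<Theta> \<Longrightarrow> (\<integral>\<^sup>+ x. ennreal (max 0 x) \<partial>offer_law lam q \<theta>) \<le> ennreal K"
    and "0 \<le> K" and \<mu>: "\<mu> \<in> space priors"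
    and V: "\<And>x \<mu>. \<mu> \<in> space priors \<Longrightarrow>
      \<exists>z. value_fun lam q \<mu>0 c W n x \<mu> (s - c) = ereal (W z)
        \<and> value_fun lam q \<mu>0 c U n x \<mu> (s - c) \<le> ereal (U z)"
  shows "(continuation lam q \<mu>0 c W (Suc n) \<mu> s = -\<infinity> \<and>
      continuation lam q \<mu>0 c U (Suc n) \<mu> s = -\<infinity>) \<or>
    (\<exists>z. continuation lam q \<mu>0 c W (Suc n) \<mu> s = ereal (W z) \<and>
      continuation lam q \<mu>0 c U (Suc n) \<mu> s \<le> ereal (U z))"
proof -
  have "offer_mixture lam q \<mu> \<in> space (prob_algebra borel)"
    using offer_mixture_measurable \<mu> by (rule measurable_space)
  then have sets[measurable_cong]: "sets (offer_mixture lam q \<mu>) = sets borel"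
    and prob: "prob_space (offer_mixture lam q \<mu>)" by (auto simp: space_prob_algebra)
  interpret prob_space "offer_mixture lam q \<mu>" by (rule prob)
  let ?Y = "\<lambda>x. value_fun lam q \<mu>0 c W n x (bayes_update q \<mu>0 x \<mu>) (s - c)"
  have "(\<lambda>x. (x, case (x, \<mu>) of (x, \<mu>) \<Rightarrow> bayes_update q \<mu>0 x \<mu>)) \<in> borel \<rightarrow>\<^sub>M borel \<Otimes>\<^sub>M priors"
    using \<mu> by (intro measurable_Pair measurable_ident_sets measurable_const
        measurable_compose[OF _ bayes_update_measurable]) auto
  from measurable_compose[OF this value_fun_measurable[OF W, of n "s - c"]]
  have Y: "?Y \<in> borel_measurable (offer_mixture lam q \<mu>)"
    by (simp cong: measurable_cong_sets)
  obtain a where "value_fun lam q \<mu>0 c W n x \<nu> (s - c) \<le> ereal (a + deriv W 0 * max 0 x)"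
    if "\<nu> \<in> space priors" for x \<nu>
    using value_fun_linear_growth[OF W K \<open>0 \<le> K\<close>] by blast
  then have "(\<integral>\<^sup>+ x. e2ennreal (?Y x) \<partial>offer_mixture lam q \<mu>) \<le> ennreal (\<bar>a\<bar> + deriv W 0 * K)"
    using smooth_utilityD(5)[OF W, of 0]
    by (intro nn_integral_linear_growth_le K \<mu> \<open>0 \<le> K\<close>) (auto intro: bayes_update_in_priors[OF \<mu>])
  then have "(\<integral>\<^sup>+ x. e2ennreal (?Y x) \<partial>offer_mixture lam q \<mu>) < \<infinity>"
    using le_less_trans ennreal_less_top by (metis infinity_ennreal_def)
  from risk_averse_Jensen[OF U W ra Y this V[OF bayes_update_in_priors[OF \<mu>]]]
  show ?thesis by (simp add: continuation_def)
qed

text \<open>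
  Here \<open>z\<close> is the sure payoff equivalent to the optimal stopping problem for \<open>W\<close>. It is real even
  if continuing has value \<open>-\<infinity>\<close>, since the current offer can be accepted; otherwise it is the
  maximum of this offer and the certainty equivalent of continuing.
\<close>

lemma value_fun_certainty_equivalent:
  assumes U: "smooth_utility U" and W: "smooth_utility W" and ra: "more_risk_averse U W"
    and K: "\<And>\<theta>. \<theta> \<in> \<Theta> \<Longrightarrow> (\<integral>\<^sup>+ x. ennreal (max 0 x) \<partial>offer_law lam q \<theta>) \<le> ennreal K"
    and "0 \<le> K" and \<mu>: "\<mu> \<in> space priors"
  shows "\<exists>z. value_fun lam q \<mu>0 c W n x \<mu> s = ereal (W z)
    \<and> value_fun lam q \<mu>0 c U n x \<mu> s \<le> ereal (U z)"
  using \<mu>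
proof (induction n arbitrary: x \<mu> s)
  case 0
  show ?case by auto
next
  case (Suc n)
  have mono: "mono U" "mono W"
    using smooth_utilityD(1)[OF U] smooth_utilityD(1)[OF W] by (auto intro: strict_mono_mono)
  note rec = value_fun_rec[of "Suc n" lam q \<mu>0 c _ x \<mu> s]
  from continuation_certainty_equivalent[OF U W ra K \<open>0 \<le> K\<close> Suc.prems Suc.IH]
  consider "continuation lam q \<mu>0 c W (Suc n) \<mu> s = -\<infinity>" "continuation lam q \<mu>0 c U (Suc n) \<mu> s = -\<infinity>"
    | z where "continuation lam q \<mu>0 c W (Suc n) \<mu> s = ereal (W z)"
        "continuation lam q \<mu>0 c U (Suc n) \<mu> s \<le> ereal (U z)"
    by blast
  then show ?case
  proof cases
    case 1
    then show ?thesis by (auto simp: rec simp del: value_fun.simps)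
  next
    case 2
    have eq: "W (max (x + s) z) = max (W (x + s)) (W z)" "U (max (x + s) z) = max (U (x + s)) (U z)"
      using mono by (simp_all add: max_of_mono)
    with 2 show ?thesis
      by (intro exI[of _ "max (x + s) z"])
        (simp add: rec eq max.coboundedI2 del: value_fun.simps)
  qed
qed

end

lemma inv_shifted_utility:
  assumes "smooth_utility U"
  shows "inv (\<lambda>x. U (x - d)) (U z) = z + d"
proof -
  have "inj (\<lambda>x. U (x - d))"
    using strict_mono_eq[OF smooth_utilityD(1)[OF assms]] by (auto simp: inj_def)
  from inv_f_f[OF this, of "z + d"] show ?thesis by simp
qed

text \<open>
  Inverts the comparison at a common payoff \<open>z\<close>. The shift \<open>d\<close> is the cost paid so far, which
  enters both certainty equivalents in the same way.
\<close>

lemma utility_inv_mono: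
  assumes U: "smooth_utility U" and W: "smooth_utility W" and "y \<le> ereal (U z)"
  shows "utility_inv (\<lambda>x. U (x - d)) y \<le> utility_inv (\<lambda>x. W (x - d)) (ereal (W z))"
proof (cases y)
  case (real u)
  with assms(3) have "u \<le> U z" by simp
  then obtain z' where z': "U z' = u" using utility_range_downward_closed[OF U] by blast
  then have "z' \<le> z"
    using \<open>u \<le> U z\<close> strict_mono_less_eq[OF smooth_utilityD(1)[OF U]] by blast
  then show ?thesis
    by (simp add: utility_inv_def real z'[symmetric] inv_shifted_utility U W)
qed (use assms(3) in \<open>auto simp: utility_inv_def\<close>)

theorem theorem4p6:
  fixes \<Theta> :: "'a :: polish_space set"
    and lam :: "real measure"
    and q :: "real \<Rightarrow> 'a \<Rightarrow> real"
    and \<mu>0 :: "'a measure"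
    and c :: real
    and U W :: "real \<Rightarrow> real"
    and N :: nat
  assumes "house_selling \<Theta> lam q \<mu>0 c"
    and "(SUP \<theta>\<in>\<Theta>. \<integral>\<^sup>+ x. ennreal (max 0 x) \<partial>offer_law lam q \<theta>) < \<infinity>"
    and "smooth_utility U" and "smooth_utility W"
    and "more_risk_averse U W"
  shows "\<forall>n<N. \<forall>\<mu>\<in>space (prob_algebra (restrict_space borel \<Theta>)).
    reservation_level lam q \<mu>0 c U n N \<mu> \<le> reservation_level lam q \<mu>0 c W n N \<mu>"
proof (intro allI impI ballI)
  interpret house_selling \<Theta> lam q \<mu>0 c by (rule assms(1))
  fix n \<mu> assume "n < N" and \<mu>: "\<mu> \<in> space (prob_algebra (restrict_space borel \<Theta>))"
  then obtain m where m: "N - n = Suc m" by (metis Suc_diff_Suc)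
  obtain K where K: "0 \<le> K"
    and "(SUP \<theta>\<in>\<Theta>. \<integral>\<^sup>+ x. ennreal (max 0 x) \<partial>offer_law lam q \<theta>) = ennreal K"
    using assms(2) less_top_ennreal by (metis infinity_ennreal_def)
  then have bound: "(\<integral>\<^sup>+ x. ennreal (max 0 x) \<partial>offer_law lam q \<theta>) \<le> ennreal K"
    if "\<theta> \<in> \<Theta>" for \<theta>
    using SUP_upper[OF that, of "\<lambda>\<theta>. \<integral>\<^sup>+ x. ennreal (max 0 x) \<partial>offer_law lam q \<theta>"] by simp
  note ce = value_fun_certainty_equivalent[OF assms(3-5) bound K]
  from continuation_certainty_equivalent[OF assms(3-5) bound K \<mu> ce, of m "- (real n * c)"]
  show "reservation_level lam q \<mu>0 c U n N \<mu> \<le> reservation_level lam q \<mu>0 c W n N \<mu>"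
    unfolding reservation_level_def m
    using utility_inv_mono[OF assms(3,4)] by (auto simp: utility_inv_def[of _ "-\<infinity>"])
qed

end
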